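(* Let $A,B,C$ be pairwise disjoint finite sets. Let $\mathcal V_{AB},\hat{\mathcal V}_{AB},\mathcal V^1_{AB},\dots,\mathcal V^k_{AB}$ be linear subspaces of $\mathbb F^{A\uplus B}$ and $\mathcal V_{BC}$ a linear subspace of $\mathbb F^{B\uplus C}$. 1. If $\mathcal V_{BC}\times B\subseteq\mathcal V_{AB}\times B$, then $\mathcal V_{BC}\leftrightarrow(\mathcal V_{AB}+_a\hat{\mathcal V}_{AB})=(\mathcal V_{BC}\leftrightarrow\mathcal V_{AB})+_a(\mathcal V_{BC}\leftrightarrow\hat{\mathcal V}_{AB})$. 2. If $\mathcal V_{BC}\times B\subseteq\mathcal V^i_{AB}\times B$ for $i=1,\dots,k-1$, then $\mathcal V_{BC}\leftrightarrow(\mathcal V^1_{AB}+_a\cdots+_a\mathcal V^k_{AB})=(\mathcal V_{BC}\leftrightarrow\mathcal V^1_{AB})+_a\cdots+_a(\mathcal V_{BC}\leftrightarrow\mathcal V^k_{AB})$. 3. If $\mathcal V_{BC}\circ B\supseteq\mathcal V_{AB}\circ B$, then $\mathcal V_{BC}\leftrightarrow(\mathcal V_{AB}+_b\hat{\mathcal V}_{AB})=(\mathcal V_{BC}\leftrightarrow\mathcal V_{AB})+_c(\mathcal V_{BC}\leftrightarrow\hat{\mathcal V}_{AB})$. 4. If $\mathcal V_{BC}\circ B\supseteq\mathcal V^i_{AB}\circ B$ for $i=1,\dots,k-1$, then $\mathcal V_{BC}\leftrightarrow(\mathcal V^1_{AB}+_b\cdots+_b\mathcal V^k_{AB})=(\mathcal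 V_{BC}\leftrightarrow\mathcal V^1_{AB})+_c\cdots+_c(\mathcal V_{BC}\leftrightarrow\mathcal V^k_{AB})$.
   Context: Fix a field $\mathbb F$; all index sets are finite. A vector on $X$ is a function $X\to\mathbb F$; for disjoint $X,Y$ a vector on $X\uplus Y$ is written $(f_X,f_Y)$, and the order of blocks is irrelevant ($\mathcal V_{XY}=\mathcal V_{YX}$). For a subspace $\mathcal V_{XY}$: restriction $\mathcal V_{XY}\circ X:=\{f_X:(f_X,g_Y)\in\mathcal V_{XY}\text{ for some }g_Y\}$; contraction $\mathcal V_{XY}\times X:=\{f_X:(f_X,0_Y)\in\mathcal V_{XY}\}$. Matched composition: $\mathcal V_{XY}\leftrightarrow\mathcal V_{YZ}:=\{(f_X,h_Z):\exists g_Y,\ (f_X,g_Y)\in\mathcal V_{XY},\ (g_Y,h_Z)\in\mathcal V_{YZ}\}$. Intersection-sum: for subspaces $\mathcal V,\hat{\mathcal V}$ on $X\uplus Y$, $\mathcal V+_y\hat{\mathcal V}:=\{(f_X,g^1_Y+g^2_Y):(f_X,g^1_Y)\in\mathcal V,\ (f_X,g^2_Y)\in\hat{\mathcal V}\}$: the lower-case subscript names the block whose components are added, while the components on the other block must be equal. Thus $+_a,+_b,+_c$ add the components on $A,B,C$ respectively. The operation is associative and commutative. *)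

theory Defs
  imports Complex_Main "HOL-Library.Function_Algebras"
begin

text \<open>
  A vector on a finite set \<open>X\<close> of indices is represented by a function on the whole index type
  that vanishes outside \<open>X\<close>.  For disjoint \<open>X\<close> and \<open>Y\<close>, the vector \<open>(f\<^sub>X, g\<^sub>Y)\<close> on
  \<open>X \<union> Y\<close> is then the pointwise sum \<open>f + g\<close> of \<open>f \<in> vecs X\<close> and \<open>g \<in> vecs Y\<close>; in particular
  the order of the blocks does not matter.
\<close>

definition vecs :: "'i set \<Rightarrow> ('i \<Rightarrow> 'f::field) set" where
  "vecs X = {f. \<forall>i. i \<notin> X \<longrightarrow> f i = 0}"

definition vscale :: "'f::field \<Rightarrow> ('i \<Rightarrow> 'f) \<Rightarrow> 'i \<Rightarrow> 'f" where
  "vscale c f = (\<lambda>i. c * f i)"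

global_interpretation fun_space: vector_space vscale
  by unfold_locales (auto simp: vscale_def fun_eq_iff algebra_simps)

definition subspace_on :: "'i set \<Rightarrow> ('i \<Rightarrow> 'f::field) set \<Rightarrow> bool" where
  "subspace_on X V \<longleftrightarrow> V \<subseteq> vecs X \<and> fun_space.subspace V"

text \<open>
  The operations take the blocks as explicit arguments, since a set of functions does not
  determine them.  They are meant for pairwise disjoint blocks.
\<close>

definition restriction :: "'i set \<Rightarrow> 'i set \<Rightarrow> ('i \<Rightarrow> 'f::field) set \<Rightarrow> ('i \<Rightarrow> 'f) set" where
  "restriction X Y V = {f \<in> vecs X. \<exists>g \<in> vecs Y. f + g \<in> V}"

text \<open>The second block of a contracted vector is the zero vector, so \<open>Y\<close> is not needed.\<close>

definition contraction :: "'i set \<Rightarrow> ('i \<Rightarrow> 'f::field) set \<Rightarrow> ('i \<Rightarrow> 'f) set" where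
  "contraction X V = {f \<in> vecs X. f + 0 \<in> V}"

text \<open>Here \<open>V\<close> lives on \<open>X \<union> Y\<close> and \<open>W\<close> on \<open>Y \<union> Z\<close>.\<close>

definition matched_comp ::
  "'i set \<Rightarrow> 'i set \<Rightarrow> 'i set \<Rightarrow> ('i \<Rightarrow> 'f::field) set \<Rightarrow> ('i \<Rightarrow> 'f) set \<Rightarrow> ('i \<Rightarrow> 'f) set" where
  "matched_comp X Y Z V W =
     {f + h | f h. f \<in> vecs X \<and> h \<in> vecs Z \<and> (\<exists>g \<in> vecs Y. f + g \<in> V \<and> g + h \<in> W)}"

text \<open>
  In \<open>isum X Y V W\<close> the components on the first block \<open>X\<close> agree and those on the second
  block \<open>Y\<close> are added.
\<close>

definition isum ::
  "'i set \<Rightarrow> 'i set \<Rightarrow> ('i \<Rightarrow> 'f::field) set \<Rightarrow> ('i \<Rightarrow> 'f) set \<Rightarrow> ('i \<Rightarrow> 'f) set" where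
  "isum X Y V W =
     {f + (g1 + g2) | f g1 g2.
        f \<in> vecs X \<and> g1 \<in> vecs Y \<and> g2 \<in> vecs Y \<and> f + g1 \<in> V \<and> f + g2 \<in> W}"

text \<open>
  The iterated sum of \<open>V 1, \<dots>, V k\<close> for \<open>k \<ge> 1\<close>, bracketed to the left; it is \<open>V 1\<close> for \<open>k = 1\<close>.
\<close>

definition isums ::
  "'i set \<Rightarrow> 'i set \<Rightarrow> nat \<Rightarrow> (nat \<Rightarrow> ('i \<Rightarrow> 'f::field) set) \<Rightarrow> ('i \<Rightarrow> 'f) set" where
  "isums X Y k V = foldl (isum X Y) (V 1) (map V [2..<Suc k])"

end

theory Submission
  imports Defs
begin

text \<open>
  Composing with \<open>V_BC\<close> distributes over an intersection-sum because, for a linear \<open>V_BC\<close>, the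
  partial data glued on the shared block \<open>B\<close> can be readjusted.

  For the sum on \<open>A\<close>, the right-hand side supplies \<open>(c, b1)\<close> and \<open>(c, b2)\<close> in \<open>V_BC\<close>, with \<open>b1\<close>
  and \<open>b2\<close> continuing to \<open>a1\<close> and \<open>a2\<close> respectively, whereas the left-hand side demands
  one common \<open>b\<close>.  By linearity \<open>b2 - b1\<close> lies in the contraction of \<open>V_BC\<close> to \<open>B\<close>, hence in
  that of \<open>V_AB\<close>, and adding it moves \<open>(b1, a1)\<close> to \<open>(b2, a1)\<close> inside \<open>V_AB\<close>
  (\<open>matched_comp_isum_outer\<close>).  Dually, for the sum on \<open>B\<close>, the left-hand side supplies a single
  \<open>c\<close> for \<open>b1 + b2\<close>, and it has to be split into a \<open>c1\<close> for \<open>b1\<close> and a \<open>c2\<close> for \<open>b2\<close>.  The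
  restriction hypothesis provides a \<open>c1\<close>, and linearity then makes \<open>c - c1\<close> a valid \<open>c2\<close>
  (\<open>matched_comp_isum_shared\<close>).

  The iterated versions follow by induction along the left bracketing (\<open>isums_hom\<close>).  The binary
  laws put their condition on the left summand, which in each step is the sum of the earlier
  subspaces and so never involves the last one.  It remains to see that the conditions pass from
  single subspaces to their sums: for contractions this is \<open>contraction_isum\<close>, together with
  linearity of the sum, and for restrictions it is \<open>restriction_isum\<close>, because the restriction of
  \<open>V_BC\<close> is closed under addition.
\<close>

section \<open>Unique decomposition into blocks\<close>

lemma vecs_add: "f \<in> vecs X \<Longrightarrow> g \<in> vecs X \<Longrightarrow> f + g \<in> vecs X"
  by (simp add: vecs_def)

lemma vecs_diff: "f \<in> vecs X \<Longrightarrow> g \<in> vecs X \<Longrightarrow> f - g \<in> vecs X"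
  by (simp add: vecs_def)

lemma zero_in_vecs: "0 \<in> vecs X"
  by (simp add: vecs_def)

lemma block_decomposition_unique:
  assumes "X \<inter> Y = {}" and "f \<in> vecs X" "f' \<in> vecs X" "g \<in> vecs Y" "g' \<in> vecs Y"
    and eq: "f + g = f' + g'"
  shows "f = f'" "g = g'"
proof -
  have "f i = f' i \<and> g i = g' i" for i
  proof (cases "i \<in> X")
    case True
    then have "g i = 0" "g' i = 0" using assms(1,4,5) by (auto simp: vecs_def)
    then show ?thesis using fun_cong[OF eq, of i] by simp
  next
    case False
    then have "f i = 0" "f' i = 0" using assms(2,3) by (auto simp: vecs_def)
    then show ?thesis using fun_cong[OF eq, of i] by simp
  qed
  then show "f = f'" "g = g'" by auto
qed

text \<open>
  On disjoint blocks the sums in the definitions below can be read as pairs: the representation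
  of a given \<open>f + h\<close> hidden in the set comprehension has to be the visible one.
\<close>

lemma add_in_matched_comp_iff:
  assumes "X \<inter> Z = {}" "f \<in> vecs X" "h \<in> vecs Z"
  shows "f + h \<in> matched_comp X Y Z V W \<longleftrightarrow> (\<exists>g \<in> vecs Y. f + g \<in> V \<and> g + h \<in> W)"
  unfolding matched_comp_def
  using assms block_decomposition_unique[OF assms(1)] by blast

lemma add_in_isum_iff:
  assumes "X \<inter> Y = {}" "f \<in> vecs X" "g \<in> vecs Y"
  shows "f + g \<in> isum X Y V W \<longleftrightarrow>
    (\<exists>g1 \<in> vecs Y. \<exists>g2 \<in> vecs Y. g = g1 + g2 \<and> f + g1 \<in> V \<and> f + g2 \<in> W)"
proof
  assume "f + g \<in> isum X Y V W"
  then obtain f' g1 g2 where *: "f + g = f' + (g1 + g2)" "f' \<in> vecs X" "g1 \<in> vecs Y" "g2 \<in> vecs Y"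
      "f' + g1 \<in> V" "f' + g2 \<in> W"
    unfolding isum_def by blast
  from block_decomposition_unique[OF assms(1,2) *(2) assms(3) vecs_add[OF *(3,4)] *(1)] *
  show "\<exists>g1 \<in> vecs Y. \<exists>g2 \<in> vecs Y. g = g1 + g2 \<and> f + g1 \<in> V \<and> f + g2 \<in> W"
    by blast
next
  assume "\<exists>g1 \<in> vecs Y. \<exists>g2 \<in> vecs Y. g = g1 + g2 \<and> f + g1 \<in> V \<and> f + g2 \<in> W"
  then show "f + g \<in> isum X Y V W"
    using assms(2) unfolding isum_def by blast
qed

section \<open>Composition and a single intersection-sum\<close>

text \<open>
  The summed block \<open>A\<close> is an outer block of the composition, while the two summands have to agree
  on the block \<open>B\<close> that the composition eliminates.  The contraction hypothesis compensates for
  the freedom in the choice of the eliminated vector.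
\<close>

lemma matched_comp_isum_outer:
  assumes disj: "A \<inter> B = {}" "A \<inter> C = {}"
    and U: "fun_space.subspace U" and V: "fun_space.subspace V"
    and sub: "contraction B U \<subseteq> contraction B V"
  shows "matched_comp C B A U (isum B A V W) =
    isum C A (matched_comp C B A U V) (matched_comp C B A U W)"
    (is "?L = ?R")
proof (intro set_eqI iffI)
  fix x assume "x \<in> ?L"
  then obtain c b a where x: "x = c + a" and v: "c \<in> vecs C" "b \<in> vecs B" "a \<in> vecs A"
    and U1: "c + b \<in> U" and "b + a \<in> isum B A V W"
    unfolding matched_comp_def by blast
  moreover have "B \<inter> A = {}" "C \<inter> A = {}" using disj by auto
  ultimately obtain a1 a2 where a: "a = a1 + a2" "a1 \<in> vecs A" "a2 \<in> vecs A"
    and VW: "b + a1 \<in> V" "b + a2 \<in> W"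
    using add_in_isum_iff[of B A b a] by blast
  have "c + a1 \<in> matched_comp C B A U V" "c + a2 \<in> matched_comp C B A U W"
    using U1 VW v a unfolding matched_comp_def by blast+
  then show "x \<in> ?R"
    unfolding isum_def using x v a by blast
next
  fix x assume "x \<in> ?R"
  then obtain c a1 a2 where x: "x = c + (a1 + a2)"
    and v: "c \<in> vecs C" "a1 \<in> vecs A" "a2 \<in> vecs A"
    and m: "c + a1 \<in> matched_comp C B A U V" "c + a2 \<in> matched_comp C B A U W"
    unfolding isum_def by blast
  have CA: "C \<inter> A = {}" using disj by auto
  obtain b1 where b1: "b1 \<in> vecs B" "c + b1 \<in> U" "b1 + a1 \<in> V"
    using m(1) add_in_matched_comp_iff[OF CA v(1,2)] by blast
  obtain b2 where b2: "b2 \<in> vecs B" "c + b2 \<in> U" "b2 + a2 \<in> W"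
    using m(2) add_in_matched_comp_iff[OF CA v(1,3)] by blast
  \<comment> \<open>The two choices of the eliminated vector differ by an element of \<open>V\<close>, so that \<open>b2\<close> serves both
    summands.\<close>
  have "b2 - b1 \<in> U"
    using fun_space.subspace_diff[OF U b2(2) b1(2)] by simp
  then have "b2 - b1 \<in> contraction B U"
    using b1 b2 by (simp add: contraction_def vecs_diff)
  then have "b2 - b1 \<in> V"
    using sub by (auto simp: contraction_def)
  from fun_space.subspace_add[OF V this b1(3)] have "b2 + a1 \<in> V"
    by (simp add: algebra_simps)
  then have "b2 + (a1 + a2) \<in> isum B A V W"
    using b2 v unfolding isum_def by blast
  then show "x \<in> ?L"
    unfolding matched_comp_def using x v b2 vecs_add by blast
qed

text \<open>
  Here the summed block \<open>B\<close> is itself eliminated by the composition, and the addition resurfaces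
  on the block \<open>C\<close> of the linear space \<open>U\<close>.
\<close>

lemma matched_comp_isum_shared:
  assumes disj: "A \<inter> B = {}" "A \<inter> C = {}"
    and U: "fun_space.subspace U"
    and sub: "restriction B A V \<subseteq> restriction B C U"
  shows "matched_comp C B A U (isum A B V W) =
    isum A C (matched_comp C B A U V) (matched_comp C B A U W)"
    (is "?L = ?R")
proof (intro set_eqI iffI)
  fix x assume "x \<in> ?L"
  then obtain c b a where x: "x = c + a" and v: "c \<in> vecs C" "b \<in> vecs B" "a \<in> vecs A"
    and U1: "c + b \<in> U" and "a + b \<in> isum A B V W"
    unfolding matched_comp_def by (auto simp: add.commute)
  then obtain b1 b2 where b: "b = b1 + b2" "b1 \<in> vecs B" "b2 \<in> vecs B"
    and VW: "a + b1 \<in> V" "a + b2 \<in> W"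
    using add_in_isum_iff[OF disj(1)] by blast
  have "b1 \<in> restriction B A V"
    using b v VW by (auto simp: restriction_def add.commute)
  then obtain c1 where c1: "c1 \<in> vecs C" "b1 + c1 \<in> U"
    using sub by (auto simp: restriction_def)
  have "(c - c1) + b2 \<in> U"
    using fun_space.subspace_diff[OF U U1 c1(2)] b(1) by (simp add: algebra_simps)
  moreover have "c1 + b1 \<in> U" "b1 + a \<in> V" "b2 + a \<in> W"
    using c1 VW by (simp_all add: add.commute)
  moreover have c2: "c - c1 \<in> vecs C"
    using v c1 by (simp add: vecs_diff)
  ultimately have "c1 + a \<in> matched_comp C B A U V" "(c - c1) + a \<in> matched_comp C B A U W"
    using v b c1 unfolding matched_comp_def by blast+
  then have "a + c1 \<in> matched_comp C B A U V" "a + (c - c1) \<in> matched_comp C B A U W"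
    by (simp_all only: add.commute)
  moreover have "x = a + (c1 + (c - c1))"
    using x by simp
  ultimately show "x \<in> ?R"
    unfolding isum_def using v c1 c2 by blast
next
  fix x assume "x \<in> ?R"
  then obtain a c1 c2 where x: "x = a + (c1 + c2)"
    and v: "a \<in> vecs A" "c1 \<in> vecs C" "c2 \<in> vecs C"
    and m: "c1 + a \<in> matched_comp C B A U V" "c2 + a \<in> matched_comp C B A U W"
    unfolding isum_def by (auto simp: add.commute)
  have CA: "C \<inter> A = {}" using disj by auto
  obtain b1 where b1: "b1 \<in> vecs B" "c1 + b1 \<in> U" "b1 + a \<in> V"
    using m(1) add_in_matched_comp_iff[OF CA v(2,1)] by blast
  obtain b2 where b2: "b2 \<in> vecs B" "c2 + b2 \<in> U" "b2 + a \<in> W"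
    using m(2) add_in_matched_comp_iff[OF CA v(3,1)] by blast
  have U12: "(c1 + c2) + (b1 + b2) \<in> U"
    using fun_space.subspace_add[OF U b1(2) b2(2)] by (simp add: algebra_simps)
  have "a + b1 \<in> V" "a + b2 \<in> W"
    using b1 b2 by (simp_all add: add.commute)
  then have "a + (b1 + b2) \<in> isum A B V W"
    using b1 b2 v unfolding isum_def by blast
  then have "(b1 + b2) + a \<in> isum A B V W"
    by (simp only: add.commute)
  then have "(c1 + c2) + a \<in> ?L"
    unfolding matched_comp_def using U12 v b1 b2 vecs_add by blast
  then show "x \<in> ?L"
    using x by (simp add: add.commute)
qed

section \<open>Iterated intersection-sums\<close>

lemma isums_one: "isums X Y (Suc 0) V = V 1"
  by (simp add: isums_def)

lemma isums_Suc: "1 \<le> k \<Longrightarrow> isums X Y (Suc k) V = isum X Y (isums X Y k V) (V (Suc k))"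
  by (simp add: isums_def)

text \<open>
  A map \<open>F\<close> that commutes with a binary sum whenever the left summand satisfies \<open>P\<close> commutes with
  iterated sums.  In the bracketing to the left \<open>V k\<close> is never part of a left summand, so that \<open>P\<close> is
  asked only of the others.
\<close>

lemma isums_hom:
  assumes k: "1 \<le> k"
    and P: "\<And>i. i \<in> {1..k - 1} \<Longrightarrow> P (V i)"
    and closed: "\<And>S T. P S \<Longrightarrow> P T \<Longrightarrow> P (isum X Y S T)"
    and hom: "\<And>S T. P S \<Longrightarrow> F (isum X Y S T) = isum X' Y' (F S) (F T)"
  shows "F (isums X Y k V) = isums X' Y' k (\<lambda>i. F (V i))"
proof -
  have P_isums: "P (isums X Y j V)" if "1 \<le> j" "j < k" for j
    using that
  proof (induction j rule: nat_induct_at_least)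
    case base
    then show ?case using P by (simp add: isums_one)
  next
    case (Suc j)
    then show ?case using P by (simp add: isums_Suc closed)
  qed
  have "F (isums X Y j V) = isums X' Y' j (\<lambda>i. F (V i))" if "1 \<le> j" "j \<le> k" for j
    using that
  proof (induction j rule: nat_induct_at_least)
    case base
    then show ?case by (simp add: isums_one)
  next
    case (Suc j)
    then show ?case using P_isums by (simp add: isums_Suc hom)
  qed
  then show ?thesis using k by simp
qed

lemma subspace_isum:
  assumes V: "fun_space.subspace V" and W: "fun_space.subspace W"
  shows "fun_space.subspace (isum X Y V W)"
proof (rule fun_space.subspaceI)
  have "0 + (0 + 0) \<in> isum X Y V W"
    using fun_space.subspace_0[OF V] fun_space.subspace_0[OF W]
    unfolding isum_def by (fastforce simp: zero_in_vecs)
  then show "0 \<in> isum X Y V W" by simp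
next
  fix x y assume "x \<in> isum X Y V W" "y \<in> isum X Y V W"
  then obtain f g1 g2 f' g1' g2' where
    x: "x = f + (g1 + g2)" "f \<in> vecs X" "g1 \<in> vecs Y" "g2 \<in> vecs Y" "f + g1 \<in> V" "f + g2 \<in> W"
    and y: "y = f' + (g1' + g2')" "f' \<in> vecs X" "g1' \<in> vecs Y" "g2' \<in> vecs Y"
      "f' + g1' \<in> V" "f' + g2' \<in> W"
    unfolding isum_def by blast
  have "x + y = (f + f') + ((g1 + g1') + (g2 + g2'))"
    using x y by (simp add: algebra_simps)
  moreover have "(f + f') + (g1 + g1') \<in> V"
    using fun_space.subspace_add[OF V x(5) y(5)] by (simp add: algebra_simps)
  moreover have "(f + f') + (g2 + g2') \<in> W"
    using fun_space.subspace_add[OF W x(6) y(6)] by (simp add: algebra_simps)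
  ultimately show "x + y \<in> isum X Y V W"
    unfolding isum_def using x(2-4) y(2-4) vecs_add by blast
next
  fix r x assume "x \<in> isum X Y V W"
  then obtain f g1 g2 where
    x: "x = f + (g1 + g2)" "f \<in> vecs X" "g1 \<in> vecs Y" "g2 \<in> vecs Y" "f + g1 \<in> V" "f + g2 \<in> W"
    unfolding isum_def by blast
  have "vscale r x = vscale r f + (vscale r g1 + vscale r g2)"
    using x by (simp add: fun_space.scale_right_distrib)
  moreover have "vscale r f + vscale r g1 \<in> V"
    using fun_space.subspace_scale[OF V x(5)] by (simp add: fun_space.scale_right_distrib)
  moreover have "vscale r f + vscale r g2 \<in> W"
    using fun_space.subspace_scale[OF W x(6)] by (simp add: fun_space.scale_right_distrib)
  moreover have "vscale r f \<in> vecs X" "vscale r g1 \<in> vecs Y" "vscale r g2 \<in> vecs Y"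
    using x by (simp_all add: vecs_def vscale_def)
  ultimately show "vscale r x \<in> isum X Y V W"
    unfolding isum_def by blast
qed

lemma contraction_isum:
  "contraction B V \<inter> contraction B W \<subseteq> contraction B (isum B A V W)"
proof
  fix b assume "b \<in> contraction B V \<inter> contraction B W"
  then have b: "b \<in> vecs B" "b + 0 \<in> V" "b + 0 \<in> W"
    by (auto simp: contraction_def)
  then have "b + (0 + 0) \<in> isum B A V W"
    unfolding isum_def using zero_in_vecs by blast
  then show "b \<in> contraction B (isum B A V W)"
    using b by (simp add: contraction_def)
qed

lemma restriction_isum:
  assumes "A \<inter> B = {}" "b \<in> restriction B A (isum A B V W)"
  obtains b1 b2 where "b = b1 + b2" "b1 \<in> restriction B A V" "b2 \<in> restriction B A W"
proof -
  obtain a where a: "a \<in> vecs A" "b \<in> vecs B" "a + b \<in> isum A B V W"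
    using assms(2) by (auto simp: restriction_def add.commute)
  then obtain b1 b2 where b: "b = b1 + b2" "b1 \<in> vecs B" "b2 \<in> vecs B"
      "a + b1 \<in> V" "a + b2 \<in> W"
    using add_in_isum_iff[OF assms(1)] by blast
  have "b1 \<in> restriction B A V" "b2 \<in> restriction B A W"
    using a b by (auto simp: restriction_def add.commute)
  with b(1) show thesis by (rule that)
qed

lemma restriction_add:
  assumes U: "fun_space.subspace U" and "b1 \<in> restriction B C U" "b2 \<in> restriction B C U"
  shows "b1 + b2 \<in> restriction B C U"
proof -
  obtain c1 c2 where c: "b1 \<in> vecs B" "b2 \<in> vecs B" "c1 \<in> vecs C" "c2 \<in> vecs C"
      "b1 + c1 \<in> U" "b2 + c2 \<in> U"
    using assms(2,3) by (auto simp: restriction_def)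
  have "(b1 + b2) + (c1 + c2) \<in> U"
    using fun_space.subspace_add[OF U c(5,6)] by (simp add: algebra_simps)
  then show ?thesis
    using c vecs_add unfolding restriction_def by blast
qed

lemma matched_comp_isums_outer:
  assumes disj: "A \<inter> B = {}" "A \<inter> C = {}"
    and U: "fun_space.subspace U" and k: "1 \<le> k"
    and V: "\<And>i. i \<in> {1..k - 1} \<Longrightarrow> fun_space.subspace (V i)"
    and sub: "\<And>i. i \<in> {1..k - 1} \<Longrightarrow> contraction B U \<subseteq> contraction B (V i)"
  shows "matched_comp C B A U (isums B A k V) = isums C A k (\<lambda>i. matched_comp C B A U (V i))"
proof (rule isums_hom[OF k])
  let ?P = "\<lambda>S. fun_space.subspace S \<and> contraction B U \<subseteq> contraction B S"
  show "?P (V i)" if "i \<in> {1..k - 1}" for i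
    using that V sub by blast
  show "?P (isum B A S T)" if "?P S" "?P T" for S T
    using that subspace_isum contraction_isum by blast
  show "matched_comp C B A U (isum B A S T) =
      isum C A (matched_comp C B A U S) (matched_comp C B A U T)" if "?P S" for S T
    using that matched_comp_isum_outer[OF disj U] by blast
qed

lemma matched_comp_isums_shared:
  assumes disj: "A \<inter> B = {}" "A \<inter> C = {}"
    and U: "fun_space.subspace U" and k: "1 \<le> k"
    and sub: "\<And>i. i \<in> {1..k - 1} \<Longrightarrow> restriction B A (V i) \<subseteq> restriction B C U"
  shows "matched_comp C B A U (isums A B k V) = isums A C k (\<lambda>i. matched_comp C B A U (V i))"
proof (rule isums_hom[OF k])
  let ?P = "\<lambda>S. restriction B A S \<subseteq> restriction B C U"
  show "?P (V i)" if "i \<in> {1..k - 1}" for i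
    using that sub by blast
  show "?P (isum A B S T)" if "?P S" "?P T" for S T
  proof
    fix b assume "b \<in> restriction B A (isum A B S T)"
    then obtain b1 b2 where "b = b1 + b2" "b1 \<in> restriction B A S" "b2 \<in> restriction B A T"
      by (rule restriction_isum[OF disj(1)])
    then show "b \<in> restriction B C U"
      using that restriction_add[OF U] by blast
  qed
  show "matched_comp C B A U (isum A B S T) =
      isum A C (matched_comp C B A U S) (matched_comp C B A U T)" if "?P S" for S T
    using that matched_comp_isum_shared[OF disj U] by blast
qed

section \<open>The distributive laws\<close>

theorem theorem22:
  fixes A B C :: "'i set"
    and V_AB V'_AB V_BC :: "('i \<Rightarrow> 'f::field) set"
    and V :: "nat \<Rightarrow> ('i \<Rightarrow> 'f) set"
    and k :: nat
  assumes "finite A" "finite B" "finite C"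
    and "A \<inter> B = {}" "A \<inter> C = {}" "B \<inter> C = {}"
    and "subspace_on (A \<union> B) V_AB" "subspace_on (A \<union> B) V'_AB"
    and "subspace_on (B \<union> C) V_BC"
    and "k \<ge> 1"
    and "\<And>i. i \<in> {1..k} \<Longrightarrow> subspace_on (A \<union> B) (V i)"
  shows
    "(contraction B V_BC \<subseteq> contraction B V_AB \<longrightarrow>
        matched_comp C B A V_BC (isum B A V_AB V'_AB) =
        isum C A (matched_comp C B A V_BC V_AB) (matched_comp C B A V_BC V'_AB))
   \<and> ((\<forall>i \<in> {1..k - 1}. contraction B V_BC \<subseteq> contraction B (V i)) \<longrightarrow>
        matched_comp C B A V_BC (isums B A k V) =
        isums C A k (\<lambda>i. matched_comp C B A V_BC (V i)))
   \<and> (restriction B C V_BC \<supseteq> restriction B A V_AB \<longrightarrow>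
        matched_comp C B A V_BC (isum A B V_AB V'_AB) =
        isum A C (matched_comp C B A V_BC V_AB) (matched_comp C B A V_BC V'_AB))
   \<and> ((\<forall>i \<in> {1..k - 1}. restriction B C V_BC \<supseteq> restriction B A (V i)) \<longrightarrow>
        matched_comp C B A V_BC (isums A B k V) =
        isums A C k (\<lambda>i. matched_comp C B A V_BC (V i)))"
proof -
  have U: "fun_space.subspace V_BC" and V1: "fun_space.subspace V_AB"
    using assms by (auto simp: subspace_on_def)
  have V: "fun_space.subspace (V i)" if "i \<in> {1..k - 1}" for i
    using assms(11)[of i] that by (auto simp: subspace_on_def)
  show ?thesis
  proof (intro conjI impI)
    assume "contraction B V_BC \<subseteq> contraction B V_AB"
    then show "matched_comp C B A V_BC (isum B A V_AB V'_AB) =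
        isum C A (matched_comp C B A V_BC V_AB) (matched_comp C B A V_BC V'_AB)"
      by (rule matched_comp_isum_outer[OF assms(4,5) U V1])
  next
    assume "\<forall>i \<in> {1..k - 1}. contraction B V_BC \<subseteq> contraction B (V i)"
    then show "matched_comp C B A V_BC (isums B A k V) =
        isums C A k (\<lambda>i. matched_comp C B A V_BC (V i))"
      by (intro matched_comp_isums_outer[OF assms(4,5) U assms(10)] V) auto
  next
    assume "restriction B C V_BC \<supseteq> restriction B A V_AB"
    then show "matched_comp C B A V_BC (isum A B V_AB V'_AB) =
        isum A C (matched_comp C B A V_BC V_AB) (matched_comp C B A V_BC V'_AB)"
      by (rule matched_comp_isum_shared[OF assms(4,5) U])
  next
    assume "\<forall>i \<in> {1..k - 1}. restriction B C V_BC \<supseteq> restriction B A (V i)"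
    then show "matched_comp C B A V_BC (isums A B k V) =
        isums A C k (\<lambda>i. matched_comp C B A V_BC (V i))"
      by (intro matched_comp_isums_shared[OF assms(4,5) U assms(10)]) auto
  qed
qed

end
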